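(* For every labelled transition system $\langle\mathrm{Proc},\Sigma,\to\rangle$ over a finite alphabet $\Sigma$, $\tau_O=\tau(\sqsubseteq_{T}^{\mathrm{fin}})$ as topologies on $\mathrm{Proc}$.
   Context: A labelled transition system (LTS) is $\langle \mathrm{Proc},\Sigma,\to\rangle$ with $\Sigma$ a finite alphabet and $\to\subseteq \mathrm{Proc}\times\Sigma\times\mathrm{Proc}$. For a process $p$, $\mathrm{Trc}(p)$ is the set of finite and infinite traces of $p$; a finite word $a_1\cdots a_n\in\Sigma^*$ is in $\mathrm{Trc}(p)$ iff there are processes with $p=p_0\xrightarrow{a_1}p_1\cdots\xrightarrow{a_n}p_n$ (so the empty word is always in $\mathrm{Trc}(p)$). For a family $\mathcal F$ of subsets of $\mathrm{Proc}$, $\langle\mathcal F\rangle$ is the smallest topology on $\mathrm{Proc}$ containing $\mathcal F$. For $s\in\Sigma^*$, $O(s)=\{p\in\mathrm{Proc}\mid s\in\mathrm{Trc}(p)\}$, and $\tau_O=\langle\{O(s)\mid s\in\Sigma^*\}\rangle$. For $k\in\mathbb N$, $\mathrm{Trc}_k(p)=\mathrm{Trc}(p)\cap\Sigma^k$, and $p\sqsubseteq_T^k q\iff\mathrm{Trc}_k(p)\subseteq\mathrm{Trc}_k(q)$. $\tau(\sqsubseteq_T^k)$ is the Alexandroff topology on $\mathrm{Proc}$, i.e. the family of all subsets of $\mathrm{Proc}$ that are upward-closed with respect to the preorder $\sqsubseteq_T^k$. Finally $\tau(\sqsubseteq_T^{\mathrm{fin}})=\left\langle\bigcup_{k\ge0}\tau(\sqsubseteq_T^k)\right\rangle$.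 *)

theory Defs
  imports "HOL-Analysis.Analysis"
begin

record ('p, 'a) lts =
  Proc :: "'p set"
  Alphabet :: "'a set"
  Trans :: "('p \<times> 'a \<times> 'p) set"

definition is_lts :: "('p, 'a) lts \<Rightarrow> bool" where
  "is_lts L \<longleftrightarrow> finite (Alphabet L) \<and> Trans L \<subseteq> Proc L \<times> Alphabet L \<times> Proc L"

datatype 'a word = Fin "'a list" | Inf "nat \<Rightarrow> 'a"

text \<open>
  In both trace definitions \<open>r\<close> enumerates the processes of a run starting in \<open>p\<close>;
  for a finite word \<open>s\<close> only \<open>r 0, \<dots>, r (length s)\<close> are relevant.
\<close>

definition fin_trace :: "('p, 'a) lts \<Rightarrow> 'p \<Rightarrow> 'a list \<Rightarrow> bool" where
  "fin_trace L p s \<longleftrightarrow>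
    (\<exists>r. r 0 = p \<and> (\<forall>i < length s. (r i, s ! i, r (Suc i)) \<in> Trans L))"

definition inf_trace :: "('p, 'a) lts \<Rightarrow> 'p \<Rightarrow> (nat \<Rightarrow> 'a) \<Rightarrow> bool" where
  "inf_trace L p s \<longleftrightarrow>
    (\<exists>r. r 0 = p \<and> (\<forall>i. (r i, s i, r (Suc i)) \<in> Trans L))"

definition Trc :: "('p, 'a) lts \<Rightarrow> 'p \<Rightarrow> 'a word set" where
  "Trc L p = {Fin s | s. fin_trace L p s} \<union> {Inf s | s. inf_trace L p s}"

definition Trc_k :: "('p, 'a) lts \<Rightarrow> nat \<Rightarrow> 'p \<Rightarrow> 'a word set" where
  "Trc_k L k p = Trc L p \<inter> Fin ` {s \<in> lists (Alphabet L). length s = k}"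

definition trace_le :: "('p, 'a) lts \<Rightarrow> nat \<Rightarrow> 'p \<Rightarrow> 'p \<Rightarrow> bool" where
  "trace_le L k p q \<longleftrightarrow> Trc_k L k p \<subseteq> Trc_k L k q"

text \<open>
  The topology generated on the carrier \<open>X\<close>. Adding \<open>X\<close> to the family is needed because
  the library's generated topology has the union of the generating family as its carrier.
\<close>

definition generated_topology :: "'p set \<Rightarrow> 'p set set \<Rightarrow> 'p topology" where
  "generated_topology X F = topology_generated_by (insert X F)"

lemma topspace_generated_topology:
  assumes "F \<subseteq> Pow X"
  shows "topspace (generated_topology X F) = X"
  using assms by (auto simp: generated_topology_def)

lemma openin_generated_topology:
  assumes "U \<in> F"
  shows "openin (generated_topology X F) U"
  using assms by (simp add: generated_topology_def topology_generated_by_Basis)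

lemma generated_topology_smallest:
  assumes "topspace T = X" and "\<And>V. V \<in> F \<Longrightarrow> openin T V"
    and "openin (generated_topology X F) U"
  shows "openin T U"
proof (rule generate_topology_on_coarsest)
  show "istopology (openin T)" by simp
  show "\<And>s. s \<in> insert X F \<Longrightarrow> openin T s"
    using assms(1,2) by auto
  show "generate_topology_on (insert X F) U"
    using assms(3) by (simp add: generated_topology_def openin_topology_generated_by_iff)
qed

definition alexandroff_topology :: "'p set \<Rightarrow> ('p \<Rightarrow> 'p \<Rightarrow> bool) \<Rightarrow> 'p topology" where
  "alexandroff_topology X le =
    topology (\<lambda>U. U \<subseteq> X \<and> (\<forall>p\<in>U. \<forall>q\<in>X. le p q \<longrightarrow> q \<in> U))"

lemma openin_alexandroff_topology:
  "openin (alexandroff_topology X le) U \<longleftrightarrow>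
    U \<subseteq> X \<and> (\<forall>p\<in>U. \<forall>q\<in>X. le p q \<longrightarrow> q \<in> U)"
proof -
  have "istopology (\<lambda>U. U \<subseteq> X \<and> (\<forall>p\<in>U. \<forall>q\<in>X. le p q \<longrightarrow> q \<in> U))"
    unfolding istopology_def by blast
  then show ?thesis
    by (simp add: alexandroff_topology_def topology_inverse')
qed

definition obs :: "('p, 'a) lts \<Rightarrow> 'a list \<Rightarrow> 'p set" where
  "obs L s = {p \<in> Proc L. Fin s \<in> Trc L p}"

definition tau_O :: "('p, 'a) lts \<Rightarrow> 'p topology" where
  "tau_O L = generated_topology (Proc L) {obs L s | s. s \<in> lists (Alphabet L)}"

definition tau_T :: "('p, 'a) lts \<Rightarrow> nat \<Rightarrow> 'p topology" where
  "tau_T L k = alexandroff_topology (Proc L) (trace_le L k)"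

definition tau_T_fin :: "('p, 'a) lts \<Rightarrow> 'p topology" where
  "tau_T_fin L = generated_topology (Proc L) (\<Union>k. {U. openin (tau_T L k) U})"

end

theory Submission
  imports Defs
begin

text \<open>Turns the preorder into membership in the sets \<open>obs L s\<close>, so that principal
  up-sets can be read as intersections of them. Since \<open>obs\<close> only contains processes of
  \<open>L\<close>, \<open>q\<close> has to be one.\<close>

lemma trace_le_iff_obs:
  assumes "q \<in> Proc L"
  shows "trace_le L k p q \<longleftrightarrow>
    (\<forall>s\<in>lists (Alphabet L). length s = k \<longrightarrow> Fin s \<in> Trc L p \<longrightarrow> q \<in> obs L s)"
  using assms unfolding trace_le_def Trc_k_def obs_def by auto

lemma topspace_tau_O: "topspace (tau_O L) = Proc L"
  unfolding tau_O_def by (rule topspace_generated_topology) (auto simp: obs_def)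

lemma topspace_tau_T_fin: "topspace (tau_T_fin L) = Proc L"
  unfolding tau_T_fin_def
  by (rule topspace_generated_topology) (auto simp: tau_T_def openin_alexandroff_topology)

lemma openin_tau_O_obs: "s \<in> lists (Alphabet L) \<Longrightarrow> openin (tau_O L) (obs L s)"
  unfolding tau_O_def by (rule openin_generated_topology) blast

text \<open>The level \<open>length s\<close> is the one whose preorder compares traces as long as
  \<open>s\<close>, so a larger process inherits \<open>s\<close>.\<close>

lemma openin_tau_T_obs:
  assumes "s \<in> lists (Alphabet L)"
  shows "openin (tau_T L (length s)) (obs L s)"
  using assms unfolding tau_T_def openin_alexandroff_topology
  by (auto simp: trace_le_iff_obs obs_def)

lemma openin_tau_O_up_set:
  assumes "finite (Alphabet L)"
  shows "openin (tau_O L) {q \<in> Proc L. trace_le L k p q}"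
proof -
  let ?S = "{s \<in> lists (Alphabet L). length s = k \<and> Fin s \<in> Trc L p}"
  have "finite ?S"
    by (rule finite_subset[OF _ finite_lists_length_eq[OF assms, of k]]) auto
  \<comment> \<open>The factor \<open>topspace (tau_O L)\<close> matters when \<open>p\<close> has
    no trace of length \<open>k\<close>: then \<open>?S\<close> is empty and the bare intersection
    is \<open>UNIV\<close>.\<close>
  then have "openin (tau_O L) ((\<Inter>s\<in>?S. obs L s) \<inter> topspace (tau_O L))"
    by (intro openin_INT) (auto intro: openin_tau_O_obs)
  also have "(\<Inter>s\<in>?S. obs L s) \<inter> topspace (tau_O L) = {q \<in> Proc L. trace_le L k p q}"
    by (auto simp: topspace_tau_O trace_le_iff_obs)
  finally show ?thesis .
qed

lemma openin_tau_O_if_openin_tau_T: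
  assumes "finite (Alphabet L)" and "openin (tau_T L k) U"
  shows "openin (tau_O L) U"
proof -
  \<comment> \<open>One inclusion is reflexivity of \<open>trace_le\<close>, the other upward
    closure of \<open>U\<close>.\<close>
  have "U = (\<Union>p\<in>U. {q \<in> Proc L. trace_le L k p q})"
    using assms(2) unfolding tau_T_def openin_alexandroff_topology
    by (auto simp: trace_le_def)
  moreover have "openin (tau_O L) (\<Union>p\<in>U. {q \<in> Proc L. trace_le L k p q})"
    by (intro openin_Union) (auto intro: openin_tau_O_up_set[OF assms(1)])
  ultimately show ?thesis
    by simp
qed

text \<open>
  An open set of \<open>\<tau>(\<sqsubseteq>\<^sub>T\<^sup>k)\<close> is the union of the principal up-sets of its points. Since there are
  only finitely many words of length \<open>k\<close>, each such up-set is a finite intersection of sets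
  \<open>O(s)\<close>.
\<close>

theorem theorem4p4:
  fixes L :: "('p, 'a) lts"
  assumes "is_lts L"
  shows "tau_O L = tau_T_fin L"
proof -
  have fin: "finite (Alphabet L)"
    using assms by (simp add: is_lts_def)
  have "openin (tau_T_fin L) U" if "openin (tau_O L) U" for U
  \<comment> \<open>By minimality of a generated topology, each direction reduces to its
    generators.\<close>
  proof (rule generated_topology_smallest[OF topspace_tau_T_fin _ that[unfolded tau_O_def]])
    fix V
    assume "V \<in> {obs L s | s. s \<in> lists (Alphabet L)}"
    then obtain s where s: "s \<in> lists (Alphabet L)" and V: "V = obs L s"
      by blast
    show "openin (tau_T_fin L) V"
      unfolding tau_T_fin_def V using openin_tau_T_obs[OF s]
      by (intro openin_generated_topology UN_I[of "length s"]) simp_all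
  qed
  moreover have "openin (tau_O L) U" if "openin (tau_T_fin L) U" for U
    by (rule generated_topology_smallest[OF topspace_tau_O _ that[unfolded tau_T_fin_def]])
      (auto intro: openin_tau_O_if_openin_tau_T[OF fin])
  ultimately show ?thesis
    by (auto simp: topology_eq)
qed

end
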